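(* Let $0\le a<b$ be real numbers. If $r>1$, then $$\text{(I)}\qquad\left(\frac{n\sum_{i=1}^{n-1}[(n-i)a+ib]^r}{(n-1)\sum_{i=1}^{n}[(n+1-i)a+ib]^r}\right)^{1/r}<\frac{n}{n+1}<\left(\frac{(n+2)\sum_{i=0}^{n}[(n-i)a+ib]^r}{(n+1)\sum_{i=0}^{n+1}[(n+1-i)a+ib]^r}\right)^{1/r}$$ and $$\text{(II)}\qquad\left(\frac{\sum_{i=1}^{n-1}[(n-i)a+ib]^r}{n^r(n-1)}\right)^{1/r}<L_r(a,b)<\left(\frac{\sum_{i=0}^{n}[(n-i)a+ib]^r}{n^r(n+1)}\right)^{1/r},$$ where in the left-hand inequalities $n\ge2$ is any integer and in the right-hand inequalities $n\ge1$ is any integer. If either $r<0$ and $a>0$, or $0<r<1$, then all inequalities in (I) and (II) are reversed.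
   Context: For $a\neq b$, the $p$-logarithmic mean is $L_p(a,b)=\left[\frac{b^{p+1}-a^{p+1}}{(p+1)(b-a)}\right]^{1/p}$ for $p\in\mathbb{R}\setminus\{0,-1\}$, defined for $a,b>0$ and, when $0\ne p>-1$, also for $a,b\ge0$. For $p=-1$ and $a,b>0$, $a\ne b$, one sets $L_{-1}(a,b)=L(a,b)=\frac{b-a}{\ln b-\ln a}$ (the logarithmic mean). *)

theory Defs
  imports Complex_Main
begin

text \<open>The \<open>p\<close>-logarithmic mean of two distinct numbers, for \<open>p \<noteq> 0\<close>; at \<open>p = -1\<close> it is
  the logarithmic mean. It is meaningful for \<open>a, b > 0\<close>, and for \<open>a, b \<ge> 0\<close> when
  \<open>0 \<noteq> p > -1\<close>, where \<open>0 powr (p + 1) = 0\<close> agrees with the usual power.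
  The values outside this range (including \<open>p = 0\<close> and \<open>a = b\<close>) have no meaning.\<close>

definition log_mean :: "real \<Rightarrow> real \<Rightarrow> real \<Rightarrow> real" where
  "log_mean p a b =
     (if p = -1 then (b - a) / (ln b - ln a)
      else ((b powr (p + 1) - a powr (p + 1)) / ((p + 1) * (b - a))) powr (1 / p))"

end

theory Submission
  imports Defs
begin

text \<open>For strictly convex \<open>f\<close> let \<open>M\<^sub>n\<close> and \<open>U\<^sub>n\<close> be the averages of \<open>f\<close> over the interior points and
  over all points of the partition of \<open>[a, b]\<close> into \<open>n\<close> equal parts. Each interior point of the
  \<open>n\<close>-th partition is a convex combination of two neighbouring interior points of the \<open>(n+1)\<close>-st, and
  each point of the \<open>(n+1)\<close>-st one is a convex combination of two neighbouring points of the
  \<open>n\<close>-th; summing the convexity inequalities gives \<open>M\<^sub>n < M\<^sub>n\<^sub>+\<^sub>1\<close> and \<open>U\<^sub>n\<^sub>+\<^sub>1 < U\<^sub>n\<close>. For monotone \<open>f\<close> both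
  sequences tend to the mean value of \<open>f\<close> on \<open>[a, b]\<close>, which therefore lies strictly between them.
  With \<open>f x = x\<^sup>r\<close> (or \<open>f x = - x\<^sup>r\<close> if \<open>0 < r < 1\<close>) this becomes the theorem after extracting
  \<open>r\<close>-th roots.\<close>

section \<open>Strict convexity from an increasing derivative\<close>

definition strictly_convex_on :: "real set \<Rightarrow> (real \<Rightarrow> real) \<Rightarrow> bool" where
  "strictly_convex_on S f \<longleftrightarrow> (\<forall>x\<in>S. \<forall>y\<in>S. \<forall>t. x < y \<longrightarrow> 0 < t \<longrightarrow> t < 1 \<longrightarrow>
     f ((1 - t) * x + t * y) < (1 - t) * f x + t * f y)"

lemma strictly_convex_onD:
  "strictly_convex_on S f \<Longrightarrow> x \<in> S \<Longrightarrow> y \<in> S \<Longrightarrow> x < y \<Longrightarrow> 0 < t \<Longrightarrow> t < 1 \<Longrightarrow>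
    f ((1 - t) * x + t * y) < (1 - t) * f x + t * f y"
  unfolding strictly_convex_on_def by blast

text \<open>Uniqueness of the derivative identifies the unnamed slope supplied by \<open>MVT\<close>
  with the prescribed \<open>f'\<close>.\<close>

lemma MVT_DERIV:
  fixes f f' :: "real \<Rightarrow> real"
  assumes "x < y" "continuous_on {x..y} f"
    and "\<And>z. x < z \<Longrightarrow> z < y \<Longrightarrow> (f has_real_derivative f' z) (at z)"
  obtains z where "x < z" "z < y" "f y - f x = (y - x) * f' z"
  using MVT[of x y f] assms DERIV_unique real_differentiable_def by metis

text \<open>The mean value theorem on either side of the intermediate point yields two slopes, and
  the right one is larger. Asking for a derivative only in the open interval admits
  \<open>a = 0\<close>, where \<open>x powr r\<close> is not differentiable for
  \<open>0 < r < 1\<close>.\<close>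

lemma strictly_convex_on_deriv:
  fixes f f' :: "real \<Rightarrow> real"
  assumes cont: "continuous_on {a..b} f"
    and deriv: "\<And>z. a < z \<Longrightarrow> z < b \<Longrightarrow> (f has_real_derivative f' z) (at z)"
    and mono: "\<And>x y. a < x \<Longrightarrow> x < y \<Longrightarrow> y < b \<Longrightarrow> f' x < f' y"
  shows "strictly_convex_on {a..b} f"
  unfolding strictly_convex_on_def
proof (intro ballI allI impI)
  fix x y t :: real
  assume xy: "x \<in> {a..b}" "y \<in> {a..b}" "x < y" and t: "0 < t" "t < 1"
  define z where "z = (1 - t) * x + t * y"
  have zx: "z - x = t * (y - x)" and yz: "y - z = (1 - t) * (y - x)"
    by (simp_all add: z_def algebra_simps)
  have "0 < z - x" "0 < y - z" unfolding zx yz using xy t by simp_all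
  then have "x < z" "z < y" by simp_all
  obtain u where u: "x < u" "u < z" "f z - f x = (z - x) * f' u"
    by (rule MVT_DERIV[of x z f f'])
      (use \<open>x < z\<close> \<open>z < y\<close> xy in \<open>auto intro: deriv continuous_on_subset[OF cont]\<close>)
  obtain v where v: "z < v" "v < y" "f y - f z = (y - z) * f' v"
    by (rule MVT_DERIV[of z y f f'])
      (use \<open>x < z\<close> \<open>z < y\<close> xy in \<open>auto intro: deriv continuous_on_subset[OF cont]\<close>)
  have "f' u < f' v" using u v xy by (intro mono) auto
  \<comment> \<open>Written through the two increments, the convexity gap carries both slopes with
    the same factor \<open>t * (1 - t) * (y - x)\<close>.\<close>
  have "((1 - t) * f x + t * f y) - f z = t * (f y - f z) - (1 - t) * (f z - f x)"
    by (simp add: algebra_simps)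
  also have "\<dots> = t * (1 - t) * (y - x) * (f' v - f' u)"
    unfolding u(3) v(3) zx yz by (simp add: algebra_simps)
  also have "\<dots> > 0" using t xy \<open>f' u < f' v\<close> by simp
  finally show "f ((1 - t) * x + t * y) < (1 - t) * f x + t * f y" by (simp add: z_def)
qed

section \<open>Equidistant grids and the passage from \<open>n\<close> to \<open>n + 1\<close>
  parts\<close>

text \<open>The numerator is kept in the form of the summands in the theorem, so that those sums are
  \<open>real n powr r\<close> times sums over grid points.\<close>

definition grid :: "real \<Rightarrow> real \<Rightarrow> nat \<Rightarrow> nat \<Rightarrow> real" where
  "grid a b n i = ((real n - real i) * a + real i * b) / real n"

lemma grid_mem: "a \<le> b \<Longrightarrow> i \<le> n \<Longrightarrow> 0 < n \<Longrightarrow> grid a b n i \<in> {a..b}"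
proof -
  assume "a \<le> b" "i \<le> n" "0 < n"
  then have "real i * a \<le> real i * b" "(real n - real i) * a \<le> (real n - real i) * b"
    by (simp_all add: mult_left_mono)
  then show ?thesis using \<open>0 < n\<close> by (simp add: grid_def field_simps)
qed

lemma grid_step: "0 < n \<Longrightarrow> grid a b n (Suc i) = grid a b n i + (b - a) / real n"
  by (simp add: grid_def field_simps)

lemma grid_less_Suc: "0 < n \<Longrightarrow> a < b \<Longrightarrow> grid a b n i < grid a b n (Suc i)"
  by (simp add: grid_step)

lemma grid_0: "0 < n \<Longrightarrow> grid a b n 0 = a" and grid_n: "0 < n \<Longrightarrow> grid a b n n = b"
  by (simp_all add: grid_def)

text \<open>In units of the fine mesh, \<open>i / n\<close> exceeds \<open>i / (n + 1)\<close> by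
  \<open>(n + 1) * i / n - i = i / n\<close>, which is the weight of the right neighbour.\<close>

lemma grid_coarse_conv_fine:
  assumes "0 < n"
  shows "grid a b n i =
    (1 - real i / real n) * grid a b (Suc n) i + real i / real n * grid a b (Suc n) (Suc i)"
proof -
  have "1 + real n \<noteq> 0" by linarith
  then show ?thesis using assms
    by (simp add: grid_def divide_simps) (simp add: algebra_simps)
qed

text \<open>In units of the coarse mesh, \<open>(i + 1) / (n + 1)\<close> exceeds
  \<open>i / n\<close> by \<open>(n - i) / (n + 1)\<close>, which is the weight of the right
  neighbour.\<close>

lemma grid_fine_conv_coarse:
  assumes "0 < n"
  shows "grid a b (Suc n) (Suc i) =
    real (Suc i) / real (Suc n) * grid a b n i
    + (1 - real (Suc i) / real (Suc n)) * grid a b n (Suc i)"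
proof -
  have "1 + real n \<noteq> 0" by linarith
  then show ?thesis using assms
    by (simp add: grid_def divide_simps) (simp add: algebra_simps)
qed

section \<open>Averages over grid points and their strict monotonicity in \<open>n\<close>\<close>

text \<open>This is the \<open>M\<^sub>n\<close> of the opening comment; \<open>outer_mean\<close>
  is \<open>U\<^sub>n\<close>.\<close>

definition inner_mean :: "(real \<Rightarrow> real) \<Rightarrow> real \<Rightarrow> real \<Rightarrow> nat \<Rightarrow> real" where
  "inner_mean f a b n = (\<Sum>i=1..n-1. f (grid a b n i)) / (real n - 1)"

definition outer_mean :: "(real \<Rightarrow> real) \<Rightarrow> real \<Rightarrow> real \<Rightarrow> nat \<Rightarrow> real" where
  "outer_mean f a b n = (\<Sum>i=0..n. f (grid a b n i)) / (real n + 1)"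

lemma inner_mean_uminus: "inner_mean (\<lambda>x. - f x) a b n = - inner_mean f a b n"
  by (simp add: inner_mean_def sum_negf)

lemma outer_mean_uminus: "outer_mean (\<lambda>x. - f x) a b n = - outer_mean f a b n"
  by (simp add: outer_mean_def sum_negf)

text \<open>For \<open>1 \<le> j \<le> m\<close> the value \<open>g j\<close> collects
  \<open>1 - j / c\<close> from \<open>i = j\<close> and \<open>(j - 1) / c\<close> from
  \<open>i = j - 1\<close>, in total \<open>1 - 1 / c\<close> whatever \<open>j\<close> is. Only
  \<open>g (Suc m)\<close> has a single contribution.\<close>

lemma sum_inner_weights:
  fixes g :: "nat \<Rightarrow> real"
  shows "(\<Sum>i=1..m. (1 - real i / c) * g i + real i / c * g (Suc i)) =
    (1 - 1 / c) * (\<Sum>i=1..m. g i) + real m / c * g (Suc m)"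
  by (induction m) (simp_all add: algebra_simps add_divide_distrib)

text \<open>An inner \<open>g j\<close> collects \<open>(j + 1) / c\<close> from
  \<open>i = j\<close> and \<open>1 - j / c\<close> from \<open>i = j - 1\<close>, in total
  \<open>1 + 1 / c\<close>. The subtracted terms are the contributions that \<open>g 0\<close> and
  \<open>g m\<close> lack.\<close>

lemma sum_outer_weights:
  fixes g :: "nat \<Rightarrow> real"
  assumes "c \<noteq> 0"
  shows "(\<Sum>i<m. real (Suc i) / c * g i + (1 - real (Suc i) / c) * g (Suc i)) =
    (1 + 1 / c) * (\<Sum>i\<le>m. g i) - g 0 - real (Suc m) / c * g m"
  using assms by (induction m) (simp_all add: algebra_simps add_divide_distrib)

lemma inner_mean_less_Suc:
  assumes conv: "strictly_convex_on {a..b} f" and "a < b" "2 \<le> n"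
  shows "inner_mean f a b n < inner_mean f a b (Suc n)"
proof -
  let ?g = "\<lambda>i. f (grid a b (Suc n) i)"
  have "f (grid a b n i) < (1 - real i / real n) * ?g i + real i / real n * ?g (Suc i)"
    if "i \<in> {1..n-1}" for i
  proof -
    have "0 < n" using \<open>2 \<le> n\<close> by simp
    have "grid a b (Suc n) i \<in> {a..b}" "grid a b (Suc n) (Suc i) \<in> {a..b}"
      using that \<open>a < b\<close> by (intro grid_mem; auto)+
    moreover have "grid a b (Suc n) i < grid a b (Suc n) (Suc i)"
      using \<open>a < b\<close> by (intro grid_less_Suc) auto
    moreover have "0 < real i / real n" "real i / real n < 1" using that by auto
    ultimately show ?thesis
      unfolding grid_coarse_conv_fine[OF \<open>0 < n\<close>] by (rule strictly_convex_onD[OF conv])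
  qed
  \<comment> \<open>Strictness survives the summation because \<open>2 \<le> n\<close> makes the
    index set nonempty.\<close>
  then have "(\<Sum>i=1..n-1. f (grid a b n i)) <
      (\<Sum>i=1..n-1. (1 - real i / real n) * ?g i + real i / real n * ?g (Suc i))"
    using \<open>2 \<le> n\<close> by (intro sum_strict_mono) auto
  also have "\<dots> = (1 - 1 / real n) * (\<Sum>i=1..n-1. ?g i) + real (n - 1) / real n * ?g n"
    using sum_inner_weights[of "real n" ?g "n - 1"] \<open>2 \<le> n\<close> by simp
  \<comment> \<open>The leftover coefficient \<open>(n - 1) / n\<close> equals the common weight, so
    \<open>?g n\<close> joins the sum as its last term.\<close>
  also have "\<dots> = (1 - 1 / real n) * (\<Sum>i=1..n. ?g i)"
  proof -
    have "(\<Sum>i=1..n. ?g i) = (\<Sum>i=1..n-1. ?g i) + ?g n"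
      using \<open>2 \<le> n\<close> by (cases n) auto
    then show ?thesis using \<open>2 \<le> n\<close> by (simp add: field_simps)
  qed
  finally have "(\<Sum>i=1..n-1. f (grid a b n i)) < (1 - 1 / real n) * (\<Sum>i=1..n. ?g i)" .
  then show ?thesis using \<open>2 \<le> n\<close> by (simp add: inner_mean_def field_simps)
qed

lemma outer_mean_Suc_less:
  assumes conv: "strictly_convex_on {a..b} f" and "a < b" "1 \<le> n"
  shows "outer_mean f a b (Suc n) < outer_mean f a b n"
proof -
  let ?g = "\<lambda>i. f (grid a b n i)"
  let ?c = "real (Suc n)"
  have n: "0 < n" using \<open>1 \<le> n\<close> by simp
  have step: "f (grid a b (Suc n) (Suc i)) <
      real (Suc i) / ?c * ?g i + (1 - real (Suc i) / ?c) * ?g (Suc i)"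
    if "i \<in> {..<n}" for i
  proof -
    have "grid a b n i \<in> {a..b}" "grid a b n (Suc i) \<in> {a..b}"
      using that assms by (intro grid_mem; simp)+
    moreover have "grid a b n i < grid a b n (Suc i)" using n \<open>a < b\<close> by (rule grid_less_Suc)
    moreover have "0 < 1 - real (Suc i) / ?c" "1 - real (Suc i) / ?c < 1" using that by auto
    ultimately show ?thesis
      unfolding grid_fine_conv_coarse[OF n]
      using strictly_convex_onD[OF conv, of "grid a b n i" "grid a b n (Suc i)" "1 - real (Suc i) / ?c"]
      by simp
  qed
  have "(\<Sum>i<n. f (grid a b (Suc n) (Suc i))) <
      (\<Sum>i<n. real (Suc i) / ?c * ?g i + (1 - real (Suc i) / ?c) * ?g (Suc i))"
    using step n by (intro sum_strict_mono) auto
  \<comment> \<open>With \<open>m = n\<close> and \<open>c = n + 1\<close> both corrections have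
    coefficient 1. They are the endpoint values \<open>f a\<close> and \<open>f b\<close>, exactly
    what the full sum over the fine grid adds to its interior points.\<close>
  also have "\<dots> = (1 + 1 / ?c) * (\<Sum>i\<le>n. ?g i) - ?g 0 - ?g n"
    by (subst sum_outer_weights) auto
  finally have "(\<Sum>i<n. f (grid a b (Suc n) (Suc i))) + f a + f b < (1 + 1 / ?c) * (\<Sum>i\<le>n. ?g i)"
    using n by (simp add: grid_0 grid_n)
  moreover have "(\<Sum>i=0..Suc n. f (grid a b (Suc n) i)) =
      (\<Sum>i<n. f (grid a b (Suc n) (Suc i))) + f a + f b"
    using sum.lessThan_Suc_shift[of "\<lambda>i. f (grid a b (Suc n) i)" n]
    by (simp add: atLeast0AtMost lessThan_Suc_atMost[symmetric] grid_0 grid_n)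
  ultimately have "(\<Sum>i=0..Suc n. f (grid a b (Suc n) i)) < (1 + 1 / ?c) * (\<Sum>i=0..n. ?g i)"
    by (simp add: atLeast0AtMost)
  then have "(\<Sum>i=0..Suc n. f (grid a b (Suc n) i)) / (?c + 1) <
      (1 + 1 / ?c) * (\<Sum>i=0..n. ?g i) / (?c + 1)"
    by (intro divide_strict_right_mono) auto
  also have "\<dots> = (\<Sum>i=0..n. ?g i) / ?c"
    by (simp add: divide_simps)
  finally show ?thesis by (simp add: outer_mean_def add.commute)
qed

section \<open>Riemann sums of monotone functions and the limit of the averages\<close>

text \<open>By the mean value theorem the increment of \<open>F\<close> over each cell lies between
  the left and the right Riemann term, and the left and right sums differ by the telescoping amount
  \<open>f b - f a\<close> before scaling by the mesh.\<close>

lemma riemann_sum_bound_mono: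
  fixes f F :: "real \<Rightarrow> real"
  assumes "a < b" "0 < n" and cont: "continuous_on {a..b} F"
    and deriv: "\<And>z. a < z \<Longrightarrow> z < b \<Longrightarrow> (F has_real_derivative f z) (at z)"
    and mono: "mono_on {a..b} f"
  shows "\<bar>(\<Sum>i<n. f (grid a b n i)) - real n * ((F b - F a) / (b - a))\<bar> \<le> \<bar>f b - f a\<bar>"
proof -
  let ?g = "grid a b n"
  have step: "f (?g i) * ((b - a) / real n) \<le> F (?g (Suc i)) - F (?g i) \<and>
      F (?g (Suc i)) - F (?g i) \<le> f (?g (Suc i)) * ((b - a) / real n)" if "i < n" for i
  proof -
    have mem: "?g i \<in> {a..b}" "?g (Suc i) \<in> {a..b}"
      using that assms by (intro grid_mem; simp)+
    have less: "?g i < ?g (Suc i)" using \<open>0 < n\<close> \<open>a < b\<close> by (rule grid_less_Suc)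
    obtain z where z: "?g i < z" "z < ?g (Suc i)"
      "F (?g (Suc i)) - F (?g i) = (?g (Suc i) - ?g i) * f z"
      by (rule MVT_DERIV[OF less, of F f])
        (use mem in \<open>auto intro: deriv continuous_on_subset[OF cont]\<close>)
    have "f (?g i) \<le> f z" "f z \<le> f (?g (Suc i))"
      using z mem by (auto intro!: mono_onD[OF mono])
    then show ?thesis unfolding z(3) using assms
      by (simp add: grid_step divide_right_mono mult.commute)
  qed
  have tele: "(\<Sum>i<n. F (?g (Suc i)) - F (?g i)) = F b - F a"
    using sum_lessThan_telescope[of "\<lambda>i. F (?g i)" n] assms by (simp add: grid_0 grid_n)
  have "(\<Sum>i<n. f (?g i) * ((b - a) / real n)) \<le> F b - F a"
    "F b - F a \<le> (\<Sum>i<n. f (?g (Suc i)) * ((b - a) / real n))"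
    unfolding tele[symmetric] using step by (auto intro!: sum_mono)
  then have "(\<Sum>i<n. f (?g i)) \<le> real n * ((F b - F a) / (b - a))"
    "real n * ((F b - F a) / (b - a)) \<le> (\<Sum>i<n. f (?g (Suc i)))"
    unfolding sum_distrib_right[symmetric] using assms by (simp_all add: field_simps)
  moreover have "(\<Sum>i<n. f (?g (Suc i))) = (\<Sum>i<n. f (?g i)) + (f b - f a)"
    using sum_lessThan_telescope[of "\<lambda>i. f (?g i)" n] assms
    by (simp add: sum_subtractf grid_0 grid_n algebra_simps)
  ultimately show ?thesis by linarith
qed

text \<open>The decreasing case follows by passing to \<open>- f\<close> and \<open>- F\<close>. It
  occurs for powers with negative exponent and for negated powers with
  \<open>0 < r < 1\<close>.\<close>

lemma riemann_sum_bound: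
  fixes f F :: "real \<Rightarrow> real"
  assumes "a < b" "0 < n" and cont: "continuous_on {a..b} F"
    and deriv: "\<And>z. a < z \<Longrightarrow> z < b \<Longrightarrow> (F has_real_derivative f z) (at z)"
    and mono: "mono_on {a..b} f \<or> antimono_on {a..b} f"
  shows "\<bar>(\<Sum>i<n. f (grid a b n i)) - real n * ((F b - F a) / (b - a))\<bar> \<le> \<bar>f b - f a\<bar>"
  using mono
proof
  assume "mono_on {a..b} f"
  then show ?thesis using assms by (intro riemann_sum_bound_mono)
next
  assume anti: "antimono_on {a..b} f"
  have "\<bar>(\<Sum>i<n. - f (grid a b n i)) - real n * ((- F b - - F a) / (b - a))\<bar> \<le> \<bar>- f b - - f a\<bar>"
    by (rule riemann_sum_bound_mono)
      (use assms anti in \<open>auto intro!: derivative_intros continuous_on_minus simp: monotone_on_def\<close>)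
  then show ?thesis by (simp add: sum_negf diff_divide_distrib algebra_simps abs_minus_commute)
qed

text \<open>Replacing the denominator \<open>n\<close> by \<open>n + c\<close> changes the error by
  the constant \<open>c * L\<close>, so the total error stays bounded and vanishes after
  division.\<close>

lemma tendsto_mean_of_bounded_error:
  fixes s :: "nat \<Rightarrow> real"
  assumes "\<And>n. 2 \<le> n \<Longrightarrow> \<bar>s n - real n * L\<bar> \<le> C"
  shows "(\<lambda>n. s n / (real n + c)) \<longlonglongrightarrow> L"
proof -
  have top: "filterlim (\<lambda>n. real n + c) at_top sequentially"
    using filterlim_tendsto_add_at_top[OF tendsto_const[of c] filterlim_real_sequentially]
    by (simp add: add.commute)
  have "(\<lambda>n. s n / (real n + c) - L) \<longlonglongrightarrow> 0"
  proof (rule tendsto_0_le[where K = 1])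
    \<comment> \<open>For negative \<open>c\<close> the denominator is positive only from some index
      on.\<close>
    have "eventually (\<lambda>n. 0 < real n + c) sequentially"
      using top by (simp add: filterlim_at_top_dense)
    moreover have "eventually (\<lambda>n::nat. 2 \<le> n) sequentially" by (rule eventually_ge_at_top)
    ultimately show "eventually (\<lambda>n. norm (s n / (real n + c) - L) \<le>
        norm ((C + \<bar>c * L\<bar>) / (real n + c)) * 1) sequentially"
    proof eventually_elim
      case (elim n)
      have "s n / (real n + c) - L = (s n - real n * L - c * L) / (real n + c)"
        using elim by (simp add: field_simps)
      moreover have "\<bar>s n - real n * L - c * L\<bar> \<le> C + \<bar>c * L\<bar>"
        using assms[of n] elim by linarith
      ultimately show ?case using elim by (simp add: divide_right_mono)
    qed
    show "(\<lambda>n. (C + \<bar>c * L\<bar>) / (real n + c)) \<longlonglongrightarrow> 0"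
      by (rule real_tendsto_divide_at_top[OF tendsto_const top])
  qed
  then show ?thesis by (rule LIM_zero_cancel)
qed

text \<open>The interior sum drops the value at \<open>a\<close> from the left Riemann sum, and the
  full sum adds the value at \<open>b\<close>; either change is a bounded error.\<close>

lemma
  fixes f F :: "real \<Rightarrow> real"
  assumes "a < b" and "continuous_on {a..b} F"
    and "\<And>z. a < z \<Longrightarrow> z < b \<Longrightarrow> (F has_real_derivative f z) (at z)"
    and "mono_on {a..b} f \<or> antimono_on {a..b} f"
  shows inner_mean_tendsto: "inner_mean f a b \<longlonglongrightarrow> (F b - F a) / (b - a)"
    and outer_mean_tendsto: "outer_mean f a b \<longlonglongrightarrow> (F b - F a) / (b - a)"
proof -
  let ?S = "\<lambda>n. \<Sum>i<n. f (grid a b n i)"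
  have bound: "\<bar>?S n - real n * ((F b - F a) / (b - a))\<bar> \<le> \<bar>f b - f a\<bar>" if "2 \<le> n" for n
    using riemann_sum_bound[of a b n F f] assms that by auto
  have inner: "(\<Sum>i=1..n-1. f (grid a b n i)) = ?S n - f a" if "2 \<le> n" for n
    using that by (cases n)
      (auto simp: sum.lessThan_Suc_shift grid_0 sum.atLeast1_atMost_eq simp del: sum.lessThan_Suc)
  have outer: "(\<Sum>i=0..n. f (grid a b n i)) = ?S n + f b" if "2 \<le> n" for n
    using that by (simp add: atLeast0AtMost lessThan_Suc_atMost[symmetric] grid_n)
  \<comment> \<open>The denominator is spelled as a sum to match the previous lemma with
    \<open>c = -1\<close>.\<close>
  have "(\<lambda>n. (\<Sum>i=1..n-1. f (grid a b n i)) / (real n + - 1)) \<longlonglongrightarrow> (F b - F a) / (b - a)"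
    by (rule tendsto_mean_of_bounded_error[where C = "\<bar>f b - f a\<bar> + \<bar>f a\<bar>"])
      (use bound inner in fastforce)
  then show "inner_mean f a b \<longlonglongrightarrow> (F b - F a) / (b - a)"
    by (simp add: inner_mean_def[abs_def])
  have "(\<lambda>n. (\<Sum>i=0..n. f (grid a b n i)) / (real n + 1)) \<longlonglongrightarrow> (F b - F a) / (b - a)"
    by (rule tendsto_mean_of_bounded_error[where C = "\<bar>f b - f a\<bar> + \<bar>f b\<bar>"])
      (use bound outer in fastforce)
  then show "outer_mean f a b \<longlonglongrightarrow> (F b - F a) / (b - a)"
    by (simp add: outer_mean_def[abs_def])
qed

text \<open>Monotone convergence compares the average at \<open>Suc n\<close> with the limit only
  weakly; the strict step from \<open>n\<close> to \<open>Suc n\<close> makes the comparison at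
  \<open>n\<close> strict.\<close>

lemma
  fixes f F :: "real \<Rightarrow> real"
  assumes "a < b" and "continuous_on {a..b} F"
    and "\<And>z. a < z \<Longrightarrow> z < b \<Longrightarrow> (F has_real_derivative f z) (at z)"
    and "mono_on {a..b} f \<or> antimono_on {a..b} f"
    and conv: "strictly_convex_on {a..b} f"
  shows inner_mean_less_integral_mean: "2 \<le> n \<Longrightarrow> inner_mean f a b n < (F b - F a) / (b - a)"
    and integral_mean_less_outer_mean: "1 \<le> n \<Longrightarrow> (F b - F a) / (b - a) < outer_mean f a b n"
proof -
  assume n: "2 \<le> n"
  have "incseq (\<lambda>k. inner_mean f a b (k + Suc n))"
    using n inner_mean_less_Suc[OF conv \<open>a < b\<close>] by (intro incseq_SucI) (auto intro!: less_imp_le)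
  from incseq_le[OF this LIMSEQ_ignore_initial_segment[OF inner_mean_tendsto[OF assms(1-4)]], of 0]
  have "inner_mean f a b (Suc n) \<le> (F b - F a) / (b - a)" by simp
  with inner_mean_less_Suc[OF conv \<open>a < b\<close> n] show "inner_mean f a b n < (F b - F a) / (b - a)"
    by simp
next
  assume n: "1 \<le> n"
  have "decseq (\<lambda>k. outer_mean f a b (k + Suc n))"
    using n outer_mean_Suc_less[OF conv \<open>a < b\<close>] by (intro decseq_SucI) (auto intro!: less_imp_le)
  from decseq_ge[OF this LIMSEQ_ignore_initial_segment[OF outer_mean_tendsto[OF assms(1-4)]], of 0]
  have "(F b - F a) / (b - a) \<le> outer_mean f a b (Suc n)" by simp
  with outer_mean_Suc_less[OF conv \<open>a < b\<close> n] show "(F b - F a) / (b - a) < outer_mean f a b n"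
    by simp
qed

section \<open>Power functions, their antiderivatives and the logarithmic mean\<close>

text \<open>The derivative \<open>r * x powr (r - 1)\<close> increases in both cases: for
  \<open>r < 0\<close> the power decreases, but its factor is negative.\<close>

lemma strictly_convex_on_powr:
  fixes r :: real
  assumes "0 \<le> a" "1 < r \<or> r < 0 \<and> 0 < a"
  shows "strictly_convex_on {a..b} (\<lambda>x. x powr r)"
proof (rule strictly_convex_on_deriv)
  show "continuous_on {a..b} (\<lambda>x. x powr r)"
    using assms by (intro continuous_on_powr' continuous_intros) auto
  show "((\<lambda>x. x powr r) has_real_derivative r * z powr (r - 1)) (at z)" if "a < z" for z
    using that assms by (auto intro!: derivative_eq_intros)
  show "r * x powr (r - 1) < r * y powr (r - 1)" if "a < x" "x < y" for x y
    using that assms powr_less_mono2[of "r - 1" x y] powr_less_mono2_neg[of "r - 1" x y] by auto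
qed

lemma strictly_convex_on_uminus_powr:
  fixes r :: real
  assumes "0 \<le> a" "0 < r" "r < 1"
  shows "strictly_convex_on {a..b} (\<lambda>x. - (x powr r))"
proof (rule strictly_convex_on_deriv)
  show "continuous_on {a..b} (\<lambda>x. - (x powr r))"
    using assms by (intro continuous_on_minus continuous_on_powr' continuous_intros) auto
  show "((\<lambda>x. - (x powr r)) has_real_derivative - (r * z powr (r - 1))) (at z)" if "a < z" for z
    using that assms by (auto intro!: derivative_eq_intros)
  show "- (r * x powr (r - 1)) < - (r * y powr (r - 1))" if "a < x" "x < y" for x y
    using that assms powr_less_mono2_neg[of "r - 1" x y] by auto
qed

text \<open>The case split mirrors that of \<open>log_mean\<close>, so that a single formula covers
  both cases.\<close>

definition powr_antideriv :: "real \<Rightarrow> real \<Rightarrow> real" where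
  "powr_antideriv r x = (if r = -1 then ln x else x powr (r + 1) / (r + 1))"

lemma continuous_on_powr_antideriv:
  assumes "0 \<le> a" "0 < r \<or> 0 < a"
  shows "continuous_on {a..b} (powr_antideriv r)"
  unfolding powr_antideriv_def[abs_def] using assms
  by (cases "r = -1") (auto intro!: continuous_on_divide continuous_on_powr' continuous_on_ln)

lemma DERIV_powr_antideriv:
  assumes "0 < z"
  shows "(powr_antideriv r has_real_derivative z powr r) (at z)"
  unfolding powr_antideriv_def[abs_def] using assms
  by (cases "r = -1") (auto intro!: derivative_eq_intros simp: powr_minus divide_simps)

lemma log_mean_eq:
  assumes "0 \<le> a" "a < b" "0 < r \<or> 0 < a"
  shows "log_mean r a b = ((powr_antideriv r b - powr_antideriv r a) / (b - a)) powr (1 / r)"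
proof (cases "r = -1")
  case True
  \<comment> \<open>The quotient is thus positive, and its power with exponent
    \<open>1 / r = -1\<close> is the reciprocal, the logarithmic mean.\<close>
  then have "ln a < ln b" using assms by simp
  then show ?thesis using True assms by (simp add: log_mean_def powr_antideriv_def powr_minus)
next
  case False
  then show ?thesis
    by (simp add: log_mean_def powr_antideriv_def diff_divide_distrib[symmetric] mult.commute)
qed

lemma integral_mean_pos:
  assumes "0 \<le> a" "a < b" "0 < r \<or> 0 < a"
  shows "0 < (powr_antideriv r b - powr_antideriv r a) / (b - a)"
proof -
  obtain z where "a < z" "z < b"
    "powr_antideriv r b - powr_antideriv r a = (b - a) * z powr r"
    by (rule MVT_DERIV[of a b "powr_antideriv r" "\<lambda>z. z powr r"])
      (use assms in \<open>auto intro!: continuous_on_powr_antideriv DERIV_powr_antideriv\<close>)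
  then show ?thesis using assms by simp
qed

section \<open>Rewriting both sides of the inequalities through the averages\<close>

lemma powr_sum_grid:
  assumes "0 < n"
  shows "(\<Sum>i\<in>A. ((real n - real i) * a + real i * b) powr r) =
    real n powr r * (\<Sum>i\<in>A. grid a b n i powr r)"
proof -
  have "((real n - real i) * a + real i * b) powr r = real n powr r * grid a b n i powr r" for i
    unfolding powr_mult[symmetric] grid_def using assms by simp
  then show ?thesis by (simp add: sum_distrib_left)
qed

lemma grid_pos: "0 \<le> a \<Longrightarrow> a < b \<Longrightarrow> 0 < i \<Longrightarrow> i \<le> n \<Longrightarrow> 0 < grid a b n i"
  by (auto simp: grid_def intro!: divide_pos_pos add_nonneg_pos)

lemma inner_mean_powr_pos:
  assumes "0 \<le> a" "a < b" "2 \<le> n"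
  shows "0 < inner_mean (\<lambda>x. x powr r) a b n"
proof -
  have "0 < (\<Sum>i=1..n-1. grid a b n i powr r)"
  proof (rule sum_pos)
    show "0 < grid a b n i powr r" if "i \<in> {1..n-1}" for i
    proof -
      have "0 < i" "i \<le> n" using that by auto
      from grid_pos[OF assms(1,2) this] show ?thesis by simp
    qed
  qed (use assms in auto)
  then show ?thesis using assms by (simp add: inner_mean_def)
qed

lemma outer_mean_powr_pos:
  assumes "0 \<le> a" "a < b" "1 \<le> n"
  shows "0 < outer_mean (\<lambda>x. x powr r) a b n"
proof -
  have "0 < (\<Sum>i=0..n. grid a b n i powr r)"
    \<comment> \<open>For \<open>a = 0\<close> the term \<open>i = 0\<close> is
      \<open>0 powr r = 0\<close>, so positivity is taken from the last term, at
      \<open>b\<close>.\<close>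
    by (intro sum_pos2[of _ n]) (use assms in \<open>auto simp: grid_n\<close>)
  then show ?thesis by (simp add: outer_mean_def)
qed

lemma inner_root_eq:
  assumes "2 \<le> n"
  shows "((\<Sum>i=1..n-1. ((real n - real i) * a + real i * b) powr r)
            / (real n powr r * (real n - 1))) powr (1 / r)
    = inner_mean (\<lambda>x. x powr r) a b n powr (1 / r)"
  using assms by (subst powr_sum_grid) (auto simp: inner_mean_def)

lemma outer_root_eq:
  assumes "1 \<le> n"
  shows "((\<Sum>i=0..n. ((real n - real i) * a + real i * b) powr r)
            / (real n powr r * (real n + 1))) powr (1 / r)
    = outer_mean (\<lambda>x. x powr r) a b n powr (1 / r)"
  using assms by (subst powr_sum_grid) (auto simp: outer_mean_def)

text \<open>Homogeneity extracts \<open>(n / (n + 1)) powr r\<close>, whose \<open>r\<close>-th root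
  is the middle term of (I), and the factors \<open>n\<close> and \<open>n - 1\<close> normalise the
  sums. What remains to be compared with 1 is the quotient of consecutive averages.\<close>

lemma inner_ratio_root_eq:
  assumes "2 \<le> n" "r \<noteq> 0"
  shows "((real n * (\<Sum>i=1..n-1. ((real n - real i) * a + real i * b) powr r))
            / ((real n - 1) * (\<Sum>i=1..n. ((real n + 1 - real i) * a + real i * b) powr r))) powr (1 / r)
    = real n / (real n + 1) *
      (inner_mean (\<lambda>x. x powr r) a b n / inner_mean (\<lambda>x. x powr r) a b (Suc n)) powr (1 / r)"
proof -
  let ?A = "\<Sum>i=1..n-1. grid a b n i powr r"
  let ?R = "inner_mean (\<lambda>x. x powr r) a b n / inner_mean (\<lambda>x. x powr r) a b (Suc n)"
  let ?B = "\<Sum>i=1..n. grid a b (Suc n) i powr r"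
  have B: "(\<Sum>i=1..n. ((real n + 1 - real i) * a + real i * b) powr r) = (real n + 1) powr r * ?B"
    using powr_sum_grid[of "Suc n" a b r "{1..n}"] by (simp add: add.commute)
  have A: "(\<Sum>i=1..n-1. ((real n - real i) * a + real i * b) powr r) = real n powr r * ?A"
    using assms by (intro powr_sum_grid) auto
  have "real n * (real n powr r * ?A) / ((real n - 1) * ((real n + 1) powr r * ?B)) =
      (real n / (real n + 1)) powr r * ?R"
    by (simp add: inner_mean_def powr_divide mult.commute mult.left_commute)
  moreover have "((real n / (real n + 1)) powr r * ?R) powr (1 / r) =
      real n / (real n + 1) * ?R powr (1 / r)"
    unfolding powr_mult powr_powr using \<open>r \<noteq> 0\<close> by simp
  ultimately show ?thesis unfolding A B by simp
qed

lemma outer_ratio_root_eq: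
  assumes "1 \<le> n" "r \<noteq> 0"
  shows "(((real n + 2) * (\<Sum>i=0..n. ((real n - real i) * a + real i * b) powr r))
            / ((real n + 1) * (\<Sum>i=0..n+1. ((real n + 1 - real i) * a + real i * b) powr r))) powr (1 / r)
    = real n / (real n + 1) *
      (outer_mean (\<lambda>x. x powr r) a b n / outer_mean (\<lambda>x. x powr r) a b (Suc n)) powr (1 / r)"
proof -
  let ?A = "\<Sum>i=0..n. grid a b n i powr r"
  let ?R = "outer_mean (\<lambda>x. x powr r) a b n / outer_mean (\<lambda>x. x powr r) a b (Suc n)"
  let ?B = "\<Sum>i=0..n+1. grid a b (Suc n) i powr r"
  have B: "(\<Sum>i=0..n+1. ((real n + 1 - real i) * a + real i * b) powr r) = (real n + 1) powr r * ?B"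
    using powr_sum_grid[of "Suc n" a b r "{0..n+1}"] by (simp add: add.commute del: sum.cl_ivl_Suc)
  have A: "(\<Sum>i=0..n. ((real n - real i) * a + real i * b) powr r) = real n powr r * ?A"
    using assms by (intro powr_sum_grid) auto
  have "(real n + 2) * (real n powr r * ?A) / ((real n + 1) * ((real n + 1) powr r * ?B)) =
      (real n / (real n + 1)) powr r * ?R"
    by (simp add: outer_mean_def powr_divide add.commute mult.commute mult.left_commute del: sum.cl_ivl_Suc)
  moreover have "((real n / (real n + 1)) powr r * ?R) powr (1 / r) =
      real n / (real n + 1) * ?R powr (1 / r)"
    unfolding powr_mult powr_powr using \<open>r \<noteq> 0\<close> by simp
  ultimately show ?thesis unfolding A B by simp
qed

text \<open>Applied with \<open>s = 1 / r\<close>. For \<open>r < 0\<close> the averages compare as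
  for \<open>r > 1\<close>, and it is the root that reverses the inequalities.\<close>

lemma powr_less_powr:
  fixes x y s :: real
  assumes "0 < x" "0 < y" "0 < s \<and> x < y \<or> s < 0 \<and> y < x"
  shows "x powr s < y powr s"
  using assms powr_less_mono2[of s x y] powr_less_mono2_neg[of s y x] by auto

lemma mult_powr_quotient_less:
  fixes q x y s :: real
  assumes "0 < q" "0 < x" "0 < y" "0 < s \<and> x < y \<or> s < 0 \<and> y < x"
  shows "q * (x / y) powr s < q"
  using assms powr_less_powr[of "x / y" 1 s] by auto

lemma less_mult_powr_quotient:
  fixes q x y s :: real
  assumes "0 < q" "0 < x" "0 < y" "0 < s \<and> y < x \<or> s < 0 \<and> x < y"
  shows "q < q * (x / y) powr s"
  using assms powr_less_powr[of 1 "x / y" s] by auto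

theorem theorem3p2:
  fixes a b r :: real
  assumes "0 \<le> a" and "a < b"
  shows "(r > 1 \<longrightarrow>
      (\<forall>n::nat. n \<ge> 2 \<longrightarrow>
          ((real n * (\<Sum>i=1..n-1. ((real n - real i) * a + real i * b) powr r))
            / ((real n - 1) * (\<Sum>i=1..n. ((real n + 1 - real i) * a + real i * b) powr r))) powr (1 / r)
          < real n / (real n + 1)) \<and>
      (\<forall>n::nat. n \<ge> 1 \<longrightarrow>
          real n / (real n + 1)
          < (((real n + 2) * (\<Sum>i=0..n. ((real n - real i) * a + real i * b) powr r))
            / ((real n + 1) * (\<Sum>i=0..n+1. ((real n + 1 - real i) * a + real i * b) powr r))) powr (1 / r)) \<and>
      (\<forall>n::nat. n \<ge> 2 \<longrightarrow>
          ((\<Sum>i=1..n-1. ((real n - real i) * a + real i * b) powr r)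
            / (real n powr r * (real n - 1))) powr (1 / r)
          < log_mean r a b) \<and>
      (\<forall>n::nat. n \<ge> 1 \<longrightarrow>
          log_mean r a b
          < ((\<Sum>i=0..n. ((real n - real i) * a + real i * b) powr r)
            / (real n powr r * (real n + 1))) powr (1 / r))) \<and>
    ((r < 0 \<and> a > 0) \<or> (0 < r \<and> r < 1) \<longrightarrow>
      (\<forall>n::nat. n \<ge> 2 \<longrightarrow>
          ((real n * (\<Sum>i=1..n-1. ((real n - real i) * a + real i * b) powr r))
            / ((real n - 1) * (\<Sum>i=1..n. ((real n + 1 - real i) * a + real i * b) powr r))) powr (1 / r)
          > real n / (real n + 1)) \<and>
      (\<forall>n::nat. n \<ge> 1 \<longrightarrow>
          real n / (real n + 1)
          > (((real n + 2) * (\<Sum>i=0..n. ((real n - real i) * a + real i * b) powr r))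
            / ((real n + 1) * (\<Sum>i=0..n+1. ((real n + 1 - real i) * a + real i * b) powr r))) powr (1 / r)) \<and>
      (\<forall>n::nat. n \<ge> 2 \<longrightarrow>
          ((\<Sum>i=1..n-1. ((real n - real i) * a + real i * b) powr r)
            / (real n powr r * (real n - 1))) powr (1 / r)
          > log_mean r a b) \<and>
      (\<forall>n::nat. n \<ge> 1 \<longrightarrow>
          log_mean r a b
          > ((\<Sum>i=0..n. ((real n - real i) * a + real i * b) powr r)
            / (real n powr r * (real n + 1))) powr (1 / r)))"
proof -
  let ?M = "inner_mean (\<lambda>x. x powr r) a b" and ?U = "outer_mean (\<lambda>x. x powr r) a b"
  let ?I = "(powr_antideriv r b - powr_antideriv r a) / (b - a)"
  have q: "0 < real n / (real n + 1)" if "1 \<le> n" for n :: nat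
    using that by simp
  note pos = inner_mean_powr_pos[OF assms, of _ r] outer_mean_powr_pos[OF assms, of _ r]
  have mono: "mono_on {a..b} (\<lambda>x. x powr r)" if "0 < r"
    using that assms by (auto simp: monotone_on_def intro!: powr_mono2)
  have convex: "(\<forall>n\<ge>2. ?M n < ?M (Suc n) \<and> ?M n < ?I) \<and> (\<forall>n\<ge>1. ?U (Suc n) < ?U n \<and> ?I < ?U n)"
    if r: "1 < r \<or> r < 0 \<and> 0 < a"
  proof -
    have "strictly_convex_on {a..b} (\<lambda>x. x powr r)"
      using assms r by (intro strictly_convex_on_powr) auto
    moreover have "antimono_on {a..b} (\<lambda>x. x powr r)" if "r < 0" "0 < a"
      using that by (auto simp: monotone_on_def intro!: powr_mono2')
    then have "mono_on {a..b} (\<lambda>x. x powr r) \<or> antimono_on {a..b} (\<lambda>x. x powr r)"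
      using mono r by fastforce
    moreover have "continuous_on {a..b} (powr_antideriv r)"
      using assms r by (intro continuous_on_powr_antideriv) auto
    moreover have "(powr_antideriv r has_real_derivative z powr r) (at z)" if "a < z" for z
      using assms that by (intro DERIV_powr_antideriv) auto
    ultimately show ?thesis
      using inner_mean_less_Suc outer_mean_Suc_less inner_mean_less_integral_mean
        integral_mean_less_outer_mean \<open>a < b\<close> by meson
  qed
  \<comment> \<open>The convex results are applied to the negated power and its negated
    antiderivative; undoing the signs reverses every comparison.\<close>
  have concave: "(\<forall>n\<ge>2. ?M (Suc n) < ?M n \<and> ?I < ?M n) \<and> (\<forall>n\<ge>1. ?U n < ?U (Suc n) \<and> ?U n < ?I)"
    if r: "0 < r" "r < 1"
  proof -
    let ?f = "\<lambda>x. - (x powr r)" and ?F = "\<lambda>x. - powr_antideriv r x"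
    have "strictly_convex_on {a..b} ?f"
      using assms r by (intro strictly_convex_on_uminus_powr) auto
    moreover have "mono_on {a..b} ?f \<or> antimono_on {a..b} ?f"
      using mono r by (auto simp: monotone_on_def)
    moreover have "continuous_on {a..b} ?F"
      using assms r by (intro continuous_on_minus continuous_on_powr_antideriv) auto
    moreover have "(?F has_real_derivative ?f z) (at z)" if "a < z" for z
      using assms that by (intro DERIV_minus DERIV_powr_antideriv) auto
    ultimately have "(\<forall>n\<ge>2. inner_mean ?f a b n < inner_mean ?f a b (Suc n) \<and>
          inner_mean ?f a b n < (?F b - ?F a) / (b - a)) \<and>
        (\<forall>n\<ge>1. outer_mean ?f a b (Suc n) < outer_mean ?f a b n \<and>
          (?F b - ?F a) / (b - a) < outer_mean ?f a b n)"
      using inner_mean_less_Suc outer_mean_Suc_less inner_mean_less_integral_mean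
        integral_mean_less_outer_mean \<open>a < b\<close> by meson
    moreover have "(?F b - ?F a) / (b - a) = - ?I"
      by (simp add: minus_divide_left)
    ultimately show ?thesis by (simp add: inner_mean_uminus outer_mean_uminus)
  qed
  show ?thesis
  proof (intro conjI impI allI, goal_cases)
    case (1 n)
    then have "r \<noteq> 0" by auto
    show ?case unfolding inner_ratio_root_eq[OF 1(2) \<open>r \<noteq> 0\<close>]
      by (intro mult_powr_quotient_less) (use 1 convex pos[of n] pos[of "Suc n"] q[of n] in auto)
  next
    case (2 n)
    then have "r \<noteq> 0" by auto
    show ?case unfolding outer_ratio_root_eq[OF 2(2) \<open>r \<noteq> 0\<close>]
      by (intro less_mult_powr_quotient) (use 2 convex pos[of n] pos[of "Suc n"] q[of n] in auto)
  next
    case (3 n)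
    then show ?case
      using convex pos[of n] integral_mean_pos[OF assms, of r]
      unfolding inner_root_eq[OF 3(2)]
      by (auto simp: log_mean_eq[OF assms] intro!: powr_less_powr)
  next
    case (4 n)
    then show ?case
      using convex pos[of n] integral_mean_pos[OF assms, of r]
      unfolding outer_root_eq[OF 4(2)]
      by (auto simp: log_mean_eq[OF assms] intro!: powr_less_powr)
  next
    \<comment> \<open>From here on the inequalities are reversed: for \<open>r < 0\<close> by
      \<open>convex\<close> and the negative exponent \<open>1 / r\<close>, for
      \<open>0 < r < 1\<close> by \<open>concave\<close> and a positive one.\<close>
    case (5 n)
    then have "r \<noteq> 0" by auto
    show ?case unfolding inner_ratio_root_eq[OF 5(2) \<open>r \<noteq> 0\<close>]
      by (intro less_mult_powr_quotient) (use 5 convex concave pos[of n] pos[of "Suc n"] q[of n] in auto)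
  next
    case (6 n)
    then have "r \<noteq> 0" by auto
    show ?case unfolding outer_ratio_root_eq[OF 6(2) \<open>r \<noteq> 0\<close>]
      by (intro mult_powr_quotient_less) (use 6 convex concave pos[of n] pos[of "Suc n"] q[of n] in auto)
  next
    case (7 n)
    then show ?case
      using convex concave pos[of n] integral_mean_pos[OF assms, of r]
      unfolding inner_root_eq[OF 7(2)]
      by (auto simp: log_mean_eq[OF assms] intro!: powr_less_powr)
  next
    case (8 n)
    then show ?case
      using convex concave pos[of n] integral_mean_pos[OF assms, of r]
      unfolding outer_root_eq[OF 8(2)]
      by (auto simp: log_mean_eq[OF assms] intro!: powr_less_powr)
  qed
qed

end
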